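(* Let $K=\mathbb{F}_q$ be a finite field with $q$ odd (i.e. $2\mid q-1$). Let $r\ge 1$ and, for $1\le i\le r$, let $m_i\geq 1$, $\gamma_i\ge 1$, $k_i=2\gamma_i+1$, and let $\mathcal{G}_i$ be a graph with $m_i$ connected components, each of which is a $k_i$-cycle. Let $\mathcal{G}=\bigcup_{i=1}^{r}\mathcal{G}_i$ be the disjoint union. Then the vanishing ideal of $X_{\mathcal{G}}^{\ast}$ in $K[t_j^i \mid 1\le i\le r,\ 1\le j\le k_im_i]$ is $$\mathbf{I}(X_{\mathcal{G}}^{\ast})=\left\langle \bigcup_{i=1}^{r}\{(t_{j}^{i})^{q-1}-1\}_{j=1}^{k_{i}m_{i}}\ \cup\ \bigcup_{i=1}^{r}\bigcup_{j=1}^{m_{i}}A_{j}^{i}\right\rangle .$$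
   Context: Write $K^\ast=K\setminus\{0\}$. Superscripts $i$ on variables are indices, not powers. The vertices of $\mathcal{G}_i$ are $x^i_1,\ldots,x^i_{k_im_i}$; for $1\le j\le m_i$ the $j$-th component of $\mathcal{G}_i$ is the cycle $x^i_{(j-1)k_i+1}x^i_{(j-1)k_i+2}\cdots x^i_{jk_i}x^i_{(j-1)k_i+1}$. The edges of $\mathcal G_i$ are numbered so that, for $(j-1)k_i+1\le l< jk_i$, the $l$-th edge is $\{x^i_l,x^i_{l+1}\}$, and the $jk_i$-th edge is $\{x^i_{jk_i},x^i_{(j-1)k_i+1}\}$; the variable $t^i_l$ corresponds to the $l$-th edge of $\mathcal{G}_i$. The affine algebraic toric set $X_{\mathcal{G}}^{\ast}$ is the set of all points (one coordinate per edge of $\mathcal{G}$) whose coordinate at an edge $\{u,v\}$ is the product $uv$, as the vertex variables range independently over all values in $K^\ast$. The vanishing ideal $\mathbf{I}(X)$ of a set $X$ of points is the ideal of all polynomials vanishing at every point of $X$. For $1\le i\le r$, $1\le j\le m_i$, let $A_j^i$ be the set of all binomials $$\prod_{\alpha\in B}(t^i_\alpha)^{\frac{q-1}{2}}-\prod_{w\in B^c}(t^i_w)^{\frac{q-1}{2}},$$ where $B$ ranges over the subsets of $\{(j-1)k_i+1,\ldots,jk_i\}$ with $|B|=\gamma_i$ and $B^c=\{(j-1)k_i+1,\ldots,jk_i\}\setminus B$. *)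

theory Defs
  imports "HOL-Library.Poly_Mapping" "HOL-Library.Cardinality" "HOL-Library.Disjoint_Sets" "HOL-Algebra.Ideal"
begin

section \<open>Polynomials in a set of variables\<close>

text \<open>A polynomial is a finitely supported map from monomials to coefficients, a monomial a
  finitely supported map from variables to exponents.\<close>

type_synonym ('x, 'a) mpoly = "('x \<Rightarrow>\<^sub>0 nat) \<Rightarrow>\<^sub>0 'a"

definition mvar :: "'x \<Rightarrow> ('x, 'a::comm_ring_1) mpoly" where
  "mvar v = Poly_Mapping.single (Poly_Mapping.single v 1) 1"

definition mpoly_ring :: "'x set \<Rightarrow> ('x, 'a::comm_ring_1) mpoly ring" where
  "mpoly_ring V =
    \<lparr>carrier = {p. \<forall>m\<in>Poly_Mapping.keys p. Poly_Mapping.keys m \<subseteq> V},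
     mult = (*), one = 1, zero = 0, add = (+)\<rparr>"

definition mpoly_eval :: "('x \<Rightarrow> 'a) \<Rightarrow> ('x, 'a::comm_ring_1) mpoly \<Rightarrow> 'a" where
  "mpoly_eval P p =
    (\<Sum>m\<in>Poly_Mapping.keys p.
       Poly_Mapping.lookup p m * (\<Prod>v\<in>Poly_Mapping.keys m. P v ^ Poly_Mapping.lookup m v))"

definition vanishing_ideal :: "'x set \<Rightarrow> ('x \<Rightarrow> 'a::comm_ring_1) set \<Rightarrow> ('x, 'a) mpoly set" where
  "vanishing_ideal V X = {p \<in> carrier (mpoly_ring V). \<forall>P\<in>X. mpoly_eval P p = 0}"

text \<open>Hence the generated ideal \<open>Idl\<close> in this ring, an intersection of ideals, is the
  intended one.\<close>

lemma cring_mpoly_ring: "cring (mpoly_ring V :: ('x, 'a::comm_ring_1) mpoly ring)"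
proof -
  define C :: "('x, 'a) mpoly set" where
    "C = {p. \<forall>m\<in>Poly_Mapping.keys p. Poly_Mapping.keys m \<subseteq> V}"
  have R: "mpoly_ring V = \<lparr>carrier = C, mult = (*), one = 1, zero = 0, add = (+)\<rparr>"
    by (simp add: mpoly_ring_def C_def)
  have zero: "0 \<in> C" and one: "1 \<in> C"
    by (simp_all add: C_def)
  have add: "p + q \<in> C" if "p \<in> C" "q \<in> C" for p q
    using that Poly_Mapping.keys_add[of p q] unfolding C_def by blast
  have neg: "- p \<in> C" if "p \<in> C" for p
    using that by (simp add: C_def in_keys_iff)
  have mult: "p * q \<in> C" if "p \<in> C" "q \<in> C" for p q
    unfolding C_def mem_Collect_eq
  proof
    fix m assume "m \<in> Poly_Mapping.keys (p * q)"
    then obtain a b where ab: "m = a + b" "a \<in> Poly_Mapping.keys p" "b \<in> Poly_Mapping.keys q"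
      using keys_mult[of p q] by blast
    then have "Poly_Mapping.keys a \<subseteq> V" "Poly_Mapping.keys b \<subseteq> V"
      using that unfolding C_def by blast+
    then show "Poly_Mapping.keys m \<subseteq> V"
      using Poly_Mapping.keys_add[of a b] ab(1) by blast
  qed
  show ?thesis
    unfolding R
  proof (rule cringI)
    show "abelian_group \<lparr>carrier = C, mult = (*), one = 1, zero = 0, add = (+)\<rparr>"
    proof (rule abelian_groupI, goal_cases)
      case (6 p)
      then show ?case using neg[of p] by (intro bexI[of _ "- p"]) simp_all
    qed (simp_all add: add zero add.assoc add.commute)
    show "comm_monoid \<lparr>carrier = C, mult = (*), one = 1, zero = 0, add = (+)\<rparr>"
      by (rule comm_monoidI) (simp_all add: mult one mult.assoc mult.commute)
  qed (simp add: distrib_right)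
qed


section \<open>Graphs\<close>

record 'v ugraph =
  verts :: "'v set"
  edges :: "'v set set"

definition simple_graph :: "'v ugraph \<Rightarrow> bool" where
  "simple_graph G \<longleftrightarrow> (\<forall>e\<in>edges G. e \<subseteq> verts G \<and> card e = 2)"

definition induced_subgraph :: "'v ugraph \<Rightarrow> 'v set \<Rightarrow> 'v ugraph" where
  "induced_subgraph G S = \<lparr>verts = S, edges = {e \<in> edges G. e \<subseteq> S}\<rparr>"

definition components :: "'v ugraph \<Rightarrow> 'v ugraph set" where
  "components G = {induced_subgraph G ({(u, v). {u, v} \<in> edges G}\<^sup>* `` {w}) | w. w \<in> verts G}"

text \<open>The cycle through the entries of a list and back to the first one; a genuine cycle when the
  list has at least three entries and they are distinct.\<close>

definition cycle_graph :: "'v list \<Rightarrow> 'v ugraph" where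
  "cycle_graph xs =
    \<lparr>verts = set xs, edges = {{xs ! l, xs ! (Suc l mod length xs)} | l. l < length xs}\<rparr>"

definition union_graph :: "'i set \<Rightarrow> ('i \<Rightarrow> 'v ugraph) \<Rightarrow> 'v ugraph" where
  "union_graph I G = \<lparr>verts = (\<Union>i\<in>I. verts (G i)), edges = (\<Union>i\<in>I. edges (G i))\<rparr>"

text \<open>\<open>block k j\<close> holds the indices of the vertices, and also of the edges, of the \<open>j\<close>-th
  cycle.\<close>

definition block :: "nat \<Rightarrow> nat \<Rightarrow> nat set" where
  "block k j = {(j - 1) * k + 1 .. j * k}"

text \<open>\<open>G\<close> has the vertices \<open>x 1, \<dots>, x (k * m)\<close>, all different, and its connected components are the
  \<open>m\<close> cycles \<open>x ((j - 1) * k + 1), \<dots>, x (j * k)\<close>.\<close>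

definition cycles_labelling :: "'v ugraph \<Rightarrow> nat \<Rightarrow> nat \<Rightarrow> (nat \<Rightarrow> 'v) \<Rightarrow> bool" where
  "cycles_labelling G m k x \<longleftrightarrow>
     inj_on x {1..k * m} \<and> verts G = x ` {1..k * m} \<and>
     components G = (\<lambda>j. cycle_graph (map x (sorted_list_of_set (block k j)))) ` {1..m}"

text \<open>The \<open>l\<close>-th edge: the last index of a block is a multiple \<open>l = j * k\<close>, and there the successor
  is the first index \<open>(j - 1) * k + 1 = l + 1 - k\<close> of the block.\<close>

definition cycle_edge :: "nat \<Rightarrow> (nat \<Rightarrow> 'v) \<Rightarrow> nat \<Rightarrow> 'v set" where
  "cycle_edge k x l = {x l, x (if k dvd l then l + 1 - k else l + 1)}"


section \<open>Affine toric sets\<close>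

definition affine_toric_set :: "'v ugraph \<Rightarrow> ('v set \<Rightarrow> 'a::field) set" where
  "affine_toric_set G =
     {restrict (\<lambda>e. \<Prod>v\<in>e. y v) (edges G) | y. \<forall>v\<in>verts G. y v \<noteq> 0}"

text \<open>The points of a set \<open>X\<close> of edge-indexed points, in the coordinates numbered by \<open>\<epsilon>\<close>.\<close>

definition numbered_points :: "('x \<Rightarrow> 'e) \<Rightarrow> ('e \<Rightarrow> 'a) set \<Rightarrow> ('x \<Rightarrow> 'a) set" where
  "numbered_points \<epsilon> X = {P \<circ> \<epsilon> | P. P \<in> X}"


section \<open>The generators\<close>

abbreviation tvar :: "nat \<Rightarrow> nat \<Rightarrow> (nat \<times> nat, 'a::comm_ring_1) mpoly" where
  "tvar i l \<equiv> mvar (i, l)"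

definition A_binomials :: "nat \<Rightarrow> nat \<Rightarrow> nat \<Rightarrow> nat \<Rightarrow> nat \<Rightarrow> (nat \<times> nat, 'a::comm_ring_1) mpoly set" where
  "A_binomials q \<gamma> k i j =
     {(\<Prod>\<alpha>\<in>B. tvar i \<alpha> ^ ((q - 1) div 2)) - (\<Prod>w\<in>block k j - B. tvar i w ^ ((q - 1) div 2)) | B.
       B \<subseteq> block k j \<and> card B = \<gamma>}"

end

theory Submission
  imports Defs "HOL-Computational_Algebra.Polynomial"
begin

text \<open>An ideal that contains \<open>t\<^sup>q\<^sup>-\<^sup>1 - 1\<close> for every variable \<open>t\<close> is the vanishing ideal of its zeros in
  the torus: modulo it every polynomial is a combination of the indicator polynomials of the torus
  points, and it contains the indicator of each point at which one of its members is nonzero.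
  It remains to find the zeros of the generators. At a torus point the powers
  \<open>t\<^sup>(\<^sup>q\<^sup>-\<^sup>1\<^sup>)\<^sup>/\<^sup>2\<close> are signs, so the binomials of a cycle all say that the product of its edge
  coordinates is a square. As the cycle is odd, this is exactly the condition that the edge coordinates
  come from nonzero values at the vertices.\<close>

section \<open>Finite fields\<close>

lemma card_nonzero: "card (- {0 :: 'a::{zero, finite}}) = CARD('a) - 1"
  by (simp add: Compl_eq_Diff_UNIV)

text \<open>Multiplication by \<open>c\<close> permutes the nonzero elements, so their product
  equals itself times \<open>c ^ (CARD('a) - 1)\<close>, and the nonzero product cancels.\<close>

lemma power_CARD_minus_1:
  fixes c :: "'a::{field, finite}"
  assumes "c \<noteq> 0"
  shows "c ^ (CARD('a) - 1) = 1"
proof -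
  have "bij_betw ((*) c) (- {0}) (- {0})"
    by (rule bij_betwI[where g = "(*) (inverse c)"]) (use assms in \<open>auto simp: field_simps\<close>)
  then have "(\<Prod>x\<in>- {0}. x) = (\<Prod>x\<in>- {0}. c * x)"
    by (rule prod.reindex_bij_betw[symmetric])
  also have "\<dots> = c ^ (CARD('a) - 1) * (\<Prod>x\<in>- {0}. x)"
    by (simp add: prod.distrib card_nonzero)
  finally show ?thesis
    by simp
qed

text \<open>Translation by 1 permutes the ring, so the sum of all elements does not change when 1 is
  added to each of them.\<close>

lemma of_nat_CARD_eq_0: "of_nat CARD('a) = (0 :: 'a::{ring_1, finite})"
proof -
  have "bij_betw (\<lambda>x :: 'a. x + 1) UNIV UNIV"
    by (rule bij_betwI[where g = "\<lambda>x. x - 1"]) auto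
  then have "(\<Sum>x\<in>UNIV. x :: 'a) = (\<Sum>x\<in>UNIV. x + 1)"
    by (rule sum.reindex_bij_betw[symmetric])
  then show ?thesis
    by (simp add: sum.distrib)
qed

lemma card_roots_of_unity_le:
  fixes n :: nat
  assumes "n > 0"
  shows "card {c :: 'a::{field, finite}. c ^ n = 1} \<le> n"
proof -
  let ?p = "monom 1 n - 1 :: 'a poly"
  have "coeff ?p n = 1"
    using assms by (simp add: coeff_1)
  then have "?p \<noteq> 0"
    by force
  moreover have "degree ?p \<le> n"
    by (intro degree_diff_le) (auto simp: degree_monom_le)
  moreover have "{c. c ^ n = 1} = {c. poly ?p c = 0}"
    by (simp add: poly_monom)
  ultimately show ?thesis
    using card_poly_roots_bound[of ?p] by simp
qed

text \<open>Fewer than q - 1 elements satisfy \<open>c ^ j = 1\<close>, so some nonzero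
  \<open>g\<close> has \<open>g ^ j \<noteq> 1\<close>. Substituting \<open>inverse g * c\<close>
  for \<open>c\<close> multiplies the sum by \<open>g ^ j\<close> without changing it, hence the sum
  is 0.\<close>

lemma sum_inverse_powers:
  assumes "j > 0" "j < CARD('a) - 1"
  shows "(\<Sum>c\<in>- {0 :: 'a::{field, finite}}. inverse c ^ j) = 0"
proof -
  have "card {c :: 'a. c ^ j = 1} < card (- {0 :: 'a})"
    using card_roots_of_unity_le[OF assms(1), where 'a = 'a] assms(2) by (simp add: card_nonzero)
  then have "\<not> - {0} \<subseteq> {c :: 'a. c ^ j = 1}"
    using card_mono[of "{c :: 'a. c ^ j = 1}" "- {0}"] by auto
  then obtain g :: 'a where g: "g \<noteq> 0" "g ^ j \<noteq> 1"
    by auto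
  have "bij_betw ((*) (inverse g)) (- {0}) (- {0})"
    by (rule bij_betwI[where g = "(*) g"]) (use g in \<open>auto simp: field_simps\<close>)
  then have "(\<Sum>c\<in>- {0}. inverse c ^ j) = (\<Sum>c\<in>- {0}. inverse (inverse g * c) ^ j)"
    by (rule sum.reindex_bij_betw[symmetric])
  also have "\<dots> = g ^ j * (\<Sum>c\<in>- {0}. inverse c ^ j)"
    by (simp add: sum_distrib_left power_mult_distrib)
  finally show ?thesis
    using g by (metis mult_cancel_right1)
qed

text \<open>A counting argument: squaring is at most two-to-one, so there are at least h = (q - 1)/2
  nonzero squares. All of them satisfy \<open>c ^ h = 1\<close>, which has at most h solutions, so
  the two sets coincide.\<close>

lemma square_if_power_half_eq_1:
  fixes c :: "'a::{field, finite}"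
  assumes "odd CARD('a)" "c ^ ((CARD('a) - 1) div 2) = 1"
  obtains s where "c = s ^ 2" "s \<noteq> 0"
proof -
  let ?h = "(CARD('a) - 1) div 2"
  let ?S = "(\<lambda>s :: 'a. s ^ 2) ` (- {0})"
  \<comment> \<open>This excludes h = 0, for which the bound on the number of roots would
    fail.\<close>
  have "CARD('a) \<noteq> 1"
    using card_mono[of UNIV "{0, 1 :: 'a}"] by auto
  then have h: "2 * ?h = CARD('a) - 1" "?h > 0"
    using assms(1) by (auto elim!: oddE)
  have "- {0} \<subseteq> (\<Union>c\<in>?S. {s :: 'a. s ^ 2 = c})"
    by auto
  then have "card (- {0 :: 'a}) \<le> card (\<Union>c\<in>?S. {s :: 'a. s ^ 2 = c})"
    by (intro card_mono) auto
  also have "\<dots> \<le> (\<Sum>c\<in>?S. card {s :: 'a. s ^ 2 = c})"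
    by (rule card_UN_le) simp
  also have "\<dots> \<le> (\<Sum>c\<in>?S. 2)"
  proof (rule sum_mono)
    fix c :: 'a assume "c \<in> ?S"
    then obtain s where "c = s ^ 2" by blast
    then have "{s. s ^ 2 = c} = {s, - s}"
      by (auto simp: power2_eq_iff)
    then show "card {s. s ^ 2 = c} \<le> 2"
      using card_insert_le_m1[of 2 "{- s}" s] by simp
  qed
  finally have "?h \<le> card ?S"
    using h by (simp add: card_nonzero)
  moreover have sub: "?S \<subseteq> {c. c ^ ?h = 1}"
    using h power_CARD_minus_1[where 'a = 'a] by (auto simp flip: power_mult)
  ultimately have "?S = {c. c ^ ?h = 1}"
    using card_roots_of_unity_le[OF h(2), where 'a = 'a] by (intro card_seteq) auto
  then show ?thesis
    using assms(2) that by fastforce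
qed

section \<open>Evaluation of polynomials\<close>

definition mconst :: "'a \<Rightarrow> ('x, 'a::comm_ring_1) mpoly" where
  "mconst c = Poly_Mapping.single 0 c"

lemma mconst_simps [simp]:
  "mconst 0 = 0" "mconst 1 = 1" "mconst (- c) = - mconst c"
  "mconst (c + d) = mconst c + mconst d" "mconst (c - d) = mconst c - mconst d"
  "mconst (c * d) = mconst c * mconst d" "mconst (c ^ n) = mconst c ^ n"
proof -
  show mult: "mconst (c * d) = mconst c * mconst d" for c d
    by (simp add: mconst_def mult_single)
  show one: "mconst 1 = 1"
    by (simp add: mconst_def)
  show "mconst (c ^ n) = mconst c ^ n"
    by (induction n) (simp_all add: mult one)
qed (simp_all add: mconst_def single_add single_uminus single_diff)

lemma sum_single_lookup:
  fixes p :: "'b \<Rightarrow>\<^sub>0 'a::comm_monoid_add"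
  assumes "finite S" "Poly_Mapping.keys p \<subseteq> S"
  shows "(\<Sum>m\<in>S. Poly_Mapping.single m (Poly_Mapping.lookup p m)) = p"
proof (rule poly_mapping_eqI)
  fix k
  show "Poly_Mapping.lookup (\<Sum>m\<in>S. Poly_Mapping.single m (Poly_Mapping.lookup p m)) k =
      Poly_Mapping.lookup p k"
    using assms by (auto simp: lookup_sum lookup_single when_def in_keys_iff)
qed

text \<open>The inner product of \<open>mpoly_eval\<close>, isolated because its multiplicativity
  yields that of \<open>mpoly_eval\<close>.\<close>

definition monom_eval :: "('x \<Rightarrow> 'a) \<Rightarrow> ('x \<Rightarrow>\<^sub>0 nat) \<Rightarrow> 'a::comm_ring_1" where
  "monom_eval P m = (\<Prod>v\<in>Poly_Mapping.keys m. P v ^ Poly_Mapping.lookup m v)"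

text \<open>The additional factors are \<open>P v ^ 0 = 1\<close>. Different monomials can thus be
  compared over one common index set.\<close>

lemma monom_eval_superset:
  assumes "finite S" "Poly_Mapping.keys m \<subseteq> S"
  shows "monom_eval P m = (\<Prod>v\<in>S. P v ^ Poly_Mapping.lookup m v)"
  unfolding monom_eval_def
  by (rule prod.mono_neutral_left) (use assms in \<open>auto simp: in_keys_iff\<close>)

lemma monom_eval_add: "monom_eval P (m + n) = monom_eval P m * monom_eval P n"
proof -
  let ?S = "Poly_Mapping.keys m \<union> Poly_Mapping.keys n"
  have "monom_eval P (m + n) = (\<Prod>v\<in>?S. P v ^ Poly_Mapping.lookup (m + n) v)"
    by (rule monom_eval_superset) (simp_all add: Poly_Mapping.keys_add)
  also have "\<dots> = monom_eval P m * monom_eval P n"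
    by (simp add: monom_eval_superset[where S = ?S] lookup_add power_add prod.distrib)
  finally show ?thesis .
qed

lemma mpoly_eval_superset:
  assumes "finite S" "Poly_Mapping.keys p \<subseteq> S"
  shows "mpoly_eval P p = (\<Sum>m\<in>S. Poly_Mapping.lookup p m * monom_eval P m)"
  unfolding mpoly_eval_def monom_eval_def
  by (rule sum.mono_neutral_left) (use assms in \<open>auto simp: in_keys_iff\<close>)

lemma mpoly_eval_single: "mpoly_eval P (Poly_Mapping.single m c) = c * monom_eval P m"
  by (subst mpoly_eval_superset[where S = "{m}"]) auto

lemma mpoly_eval_add: "mpoly_eval P (p + q) = mpoly_eval P p + mpoly_eval P q"
proof -
  let ?S = "Poly_Mapping.keys p \<union> Poly_Mapping.keys q"
  have "mpoly_eval P (p + q) = (\<Sum>m\<in>?S. Poly_Mapping.lookup (p + q) m * monom_eval P m)"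
    by (rule mpoly_eval_superset) (simp_all add: Poly_Mapping.keys_add)
  also have "\<dots> = mpoly_eval P p + mpoly_eval P q"
    by (simp add: mpoly_eval_superset[where S = ?S] lookup_add distrib_right sum.distrib)
  finally show ?thesis .
qed

lemma mpoly_eval_0 [simp]: "mpoly_eval P 0 = 0"
  by (simp add: mpoly_eval_def)

lemma mpoly_eval_sum: "mpoly_eval P (\<Sum>s\<in>S. f s) = (\<Sum>s\<in>S. mpoly_eval P (f s))"
  by (induction S rule: infinite_finite_induct) (simp_all add: mpoly_eval_add)

text \<open>Both factors are expanded into single terms, where multiplication adds the exponents and
  \<open>monom_eval_add\<close> applies.\<close>

lemma mpoly_eval_mult: "mpoly_eval P (p * q) = mpoly_eval P p * mpoly_eval P q"
proof -
  let ?s = "\<lambda>p m. Poly_Mapping.single m (Poly_Mapping.lookup p m)"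
  have "p * q = (\<Sum>m\<in>Poly_Mapping.keys p. ?s p m) * (\<Sum>n\<in>Poly_Mapping.keys q. ?s q n)"
    by (simp add: sum_single_lookup)
  also have "\<dots> = (\<Sum>m\<in>Poly_Mapping.keys p. \<Sum>n\<in>Poly_Mapping.keys q.
      Poly_Mapping.single (m + n) (Poly_Mapping.lookup p m * Poly_Mapping.lookup q n))"
    by (simp add: sum_product mult_single)
  finally have "mpoly_eval P (p * q) = (\<Sum>m\<in>Poly_Mapping.keys p. \<Sum>n\<in>Poly_Mapping.keys q.
      (Poly_Mapping.lookup p m * Poly_Mapping.lookup q n) * (monom_eval P m * monom_eval P n))"
    by (simp add: mpoly_eval_sum mpoly_eval_single monom_eval_add)
  also have "\<dots> = mpoly_eval P p * mpoly_eval P q"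
    by (simp add: mpoly_eval_def monom_eval_def sum_product mult_ac)
  finally show ?thesis .
qed

lemma mpoly_eval_mconst: "mpoly_eval P (mconst c) = c"
  by (simp add: mconst_def mpoly_eval_single monom_eval_def)

lemma mpoly_eval_1 [simp]: "mpoly_eval P 1 = 1"
  by (metis mpoly_eval_mconst mconst_simps(2))

lemma mpoly_eval_mvar [simp]: "mpoly_eval P (mvar v) = P v"
  by (simp add: mvar_def mpoly_eval_single monom_eval_def)

lemma mpoly_eval_uminus: "mpoly_eval P (- p) = - mpoly_eval P p"
  using mpoly_eval_add[of P p "- p"] by (simp add: eq_neg_iff_add_eq_0 add.commute)

lemma mpoly_eval_diff: "mpoly_eval P (p - q) = mpoly_eval P p - mpoly_eval P q"
  using mpoly_eval_add[of P p "- q"] by (simp add: mpoly_eval_uminus)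

lemma mpoly_eval_power: "mpoly_eval P (p ^ n) = mpoly_eval P p ^ n"
  by (induction n) (simp_all add: mpoly_eval_mult)

lemma mpoly_eval_prod: "mpoly_eval P (\<Prod>s\<in>S. f s) = (\<Prod>s\<in>S. mpoly_eval P (f s))"
  by (induction S rule: infinite_finite_induct) (simp_all add: mpoly_eval_mult)

lemma mpoly_eval_cong:
  assumes "p \<in> carrier (mpoly_ring V)" "\<And>v. v \<in> V \<Longrightarrow> P v = Q v"
  shows "mpoly_eval P p = mpoly_eval Q p"
  unfolding mpoly_eval_def using assms
  by (intro sum.cong arg_cong2[where f = "(*)"] prod.cong arg_cong2[where f = "(^)"])
    (auto simp: mpoly_ring_def)

section \<open>Ideals of polynomials\<close>

lemma mpoly_ring_simps [simp]:
  "p \<otimes>\<^bsub>mpoly_ring V\<^esub> q = p * q" "\<one>\<^bsub>mpoly_ring V\<^esub> = 1"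
  "\<zero>\<^bsub>mpoly_ring V\<^esub> = 0" "p \<oplus>\<^bsub>mpoly_ring V\<^esub> q = p + q"
  by (simp_all add: mpoly_ring_def)

lemma mpoly_mconst_closed [simp]: "mconst c \<in> carrier (mpoly_ring V)"
  by (simp add: mpoly_ring_def mconst_def)

lemma mpoly_one_closed [simp]: "1 \<in> carrier (mpoly_ring V)"
  using mpoly_mconst_closed[of 1] by simp

lemma mpoly_zero_closed [simp]: "0 \<in> carrier (mpoly_ring V)"
  using mpoly_mconst_closed[of 0] by simp

lemma mpoly_mvar_closed [simp]: "v \<in> V \<Longrightarrow> mvar v \<in> carrier (mpoly_ring V)"
  by (simp add: mpoly_ring_def mvar_def)

lemma mpoly_mult_closed [simp]:
  "p \<in> carrier (mpoly_ring V) \<Longrightarrow> q \<in> carrier (mpoly_ring V) \<Longrightarrow> p * q \<in> carrier (mpoly_ring V)"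
  using ring.ring_simprules(5)[OF cring.axioms(1)[OF cring_mpoly_ring[of V]], of p q] by simp

lemma mpoly_add_closed [simp]:
  "p \<in> carrier (mpoly_ring V) \<Longrightarrow> q \<in> carrier (mpoly_ring V) \<Longrightarrow> p + q \<in> carrier (mpoly_ring V)"
  using ring.ring_simprules(1)[OF cring.axioms(1)[OF cring_mpoly_ring[of V]], of p q] by simp

lemma mpoly_uminus_closed [simp]:
  "p \<in> carrier (mpoly_ring V) \<Longrightarrow> - p \<in> carrier (mpoly_ring V)"
  by (simp add: mpoly_ring_def in_keys_iff)

lemma mpoly_diff_closed [simp]:
  "p \<in> carrier (mpoly_ring V) \<Longrightarrow> q \<in> carrier (mpoly_ring V) \<Longrightarrow> p - q \<in> carrier (mpoly_ring V)"
  using mpoly_add_closed[of p V "- q"] by simp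

lemma mpoly_power_closed [simp]:
  "p \<in> carrier (mpoly_ring V) \<Longrightarrow> p ^ n \<in> carrier (mpoly_ring V)"
  by (induction n) simp_all

lemma mpoly_sum_closed:
  "(\<And>s. s \<in> S \<Longrightarrow> f s \<in> carrier (mpoly_ring V)) \<Longrightarrow> (\<Sum>s\<in>S. f s) \<in> carrier (mpoly_ring V)"
  by (induction S rule: infinite_finite_induct) simp_all

lemma mpoly_prod_closed:
  "(\<And>s. s \<in> S \<Longrightarrow> f s \<in> carrier (mpoly_ring V)) \<Longrightarrow> (\<Prod>s\<in>S. f s) \<in> carrier (mpoly_ring V)"
  by (induction S rule: infinite_finite_induct) simp_all

lemma mpoly_ideal_mult:
  assumes "ideal I (mpoly_ring V)" "p \<in> carrier (mpoly_ring V)" "q \<in> I"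
  shows "p * q \<in> I"
  using ideal.I_l_closed[OF assms(1,3,2)] by simp

lemma mpoly_ideal_add:
  assumes "ideal I (mpoly_ring V)" "p \<in> I" "q \<in> I"
  shows "p + q \<in> I"
  using additive_subgroup.a_closed[OF ideal.axioms(1)[OF assms(1)] assms(2,3)] by simp

lemma mpoly_ideal_diff:
  assumes "ideal I (mpoly_ring V)" "p \<in> I" "q \<in> I"
  shows "p - q \<in> I"
  using mpoly_ideal_add[OF assms(1,2) mpoly_ideal_mult[OF assms(1) _ assms(3), of "- 1"]] by simp

lemma mpoly_ideal_sum:
  assumes "ideal I (mpoly_ring V)" "\<And>s. s \<in> S \<Longrightarrow> f s \<in> I"
  shows "(\<Sum>s\<in>S. f s) \<in> I"
proof -
  have "0 \<in> I"
    using additive_subgroup.zero_closed[OF ideal.axioms(1)[OF assms(1)]] by simp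
  then show ?thesis
    using assms(2)
    by (induction S rule: infinite_finite_induct) (simp_all add: mpoly_ideal_add[OF assms(1)])
qed

lemma ideal_vanishing_ideal:
  fixes V :: "'x set" and X :: "('x \<Rightarrow> 'a::comm_ring_1) set"
  shows "ideal (vanishing_ideal V X) (mpoly_ring V)"
proof (rule idealI)
  interpret cring "mpoly_ring V :: ('x, 'a) mpoly ring"
    by (rule cring_mpoly_ring)
  show "ring (mpoly_ring V :: ('x, 'a) mpoly ring)"
    by (rule ring_axioms)
  show "subgroup (vanishing_ideal V X) (add_monoid (mpoly_ring V))"
  proof (rule add.subgroupI)
    fix p assume p: "p \<in> vanishing_ideal V X"
    \<comment> \<open>The negative of the ring record is an abstract inverse; uniqueness of inverses
      identifies it with \<open>- p\<close>.\<close>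
    then have "- p \<oplus>\<^bsub>mpoly_ring V\<^esub> p = \<zero>\<^bsub>mpoly_ring V\<^esub>"
        "p \<in> carrier (mpoly_ring V)" "- p \<in> carrier (mpoly_ring V)"
      by (auto simp: vanishing_ideal_def)
    then have "\<ominus>\<^bsub>mpoly_ring V\<^esub> p = - p"
      by (rule minus_equality)
    then show "\<ominus>\<^bsub>mpoly_ring V\<^esub> p \<in> vanishing_ideal V X"
      using p by (simp add: vanishing_ideal_def mpoly_eval_uminus)
  qed (auto simp: vanishing_ideal_def mpoly_eval_add intro: exI[of _ 0])
qed (auto simp: vanishing_ideal_def mpoly_eval_mult)

lemma single_eq_prod_mvar:
  fixes m :: "'x \<Rightarrow>\<^sub>0 nat" and c :: "'a::comm_ring_1"
  shows "Poly_Mapping.single m c =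
    mconst c * (\<Prod>v\<in>Poly_Mapping.keys m. mvar v ^ Poly_Mapping.lookup m v)"
proof -
  have power: "mvar v ^ n = Poly_Mapping.single (Poly_Mapping.single v n) (1 :: 'a)" for v :: 'x and n :: nat
    by (induction n) (simp_all add: mvar_def mult_single flip: single_add)
  have "(\<Prod>v\<in>S. mvar v ^ n v) = Poly_Mapping.single (\<Sum>v\<in>S. Poly_Mapping.single v (n v)) (1 :: 'a)"
    for S and n :: "'x \<Rightarrow> nat"
    by (induction S rule: infinite_finite_induct) (simp_all add: power mult_single)
  then show ?thesis
    by (simp add: sum_single_lookup mconst_def mult_single)
qed

text \<open>Every element of the ring is a sum of constants times products of powers of variables in
  \<open>V\<close>, which gives structural induction on polynomials.\<close>

lemma mpoly_carrier_induct [consumes 1, case_names const var add mult]: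
  fixes p :: "('x, 'a::comm_ring_1) mpoly"
  assumes p: "p \<in> carrier (mpoly_ring V)"
    and const: "\<And>c. Q (mconst c)"
    and var: "\<And>v. v \<in> V \<Longrightarrow> Q (mvar v)"
    and add: "\<And>p q. \<lbrakk>p \<in> carrier (mpoly_ring V); q \<in> carrier (mpoly_ring V); Q p; Q q\<rbrakk> \<Longrightarrow> Q (p + q)"
    and mult: "\<And>p q. \<lbrakk>p \<in> carrier (mpoly_ring V); q \<in> carrier (mpoly_ring V); Q p; Q q\<rbrakk> \<Longrightarrow> Q (p * q)"
  shows "Q p"
proof -
  \<comment> \<open>Membership in the ring is carried along with \<open>Q\<close>, since the cases
    \<open>add\<close> and \<open>mult\<close> presuppose it.\<close>
  let ?C = "\<lambda>p. p \<in> carrier (mpoly_ring V) \<and> Q p"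
  have power: "?C (p ^ n)" if "?C p" for p n
    using that const[of 1] by (induction n) (simp_all add: mult)
  have prod: "?C (\<Prod>s\<in>S. f s)" if "\<And>s. s \<in> S \<Longrightarrow> ?C (f s)" for S and f :: "'x \<Rightarrow> _"
    using that const[of 1] by (induction S rule: infinite_finite_induct) (simp_all add: mult)
  have sum: "?C (\<Sum>s\<in>S. f s)" if "\<And>s. s \<in> S \<Longrightarrow> ?C (f s)" for S and f :: "('x \<Rightarrow>\<^sub>0 nat) \<Rightarrow> _"
    using that const[of 0] by (induction S rule: infinite_finite_induct) (simp_all add: add)
  have "?C (Poly_Mapping.single m c)" if "Poly_Mapping.keys m \<subseteq> V" for m c
  proof -
    have "?C (\<Prod>v\<in>Poly_Mapping.keys m. mvar v ^ Poly_Mapping.lookup m v)"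
      using that by (intro prod power) (auto simp: var)
    then show ?thesis
      by (simp add: single_eq_prod_mvar mult const)
  qed
  then have "?C (\<Sum>m\<in>Poly_Mapping.keys p. Poly_Mapping.single m (Poly_Mapping.lookup p m))"
    using p by (intro sum) (auto simp: mpoly_ring_def)
  then show ?thesis
    by (simp add: sum_single_lookup)
qed

section \<open>A Nullstellensatz for tori over finite fields\<close>

text \<open>Modulo \<open>t\<^sub>v\<^sup>q\<^sup>-\<^sup>1 - 1\<close> this is the indicator function of \<open>t\<^sub>v = c\<close>, since \<open>q - 1 = -1\<close> in the field.\<close>

definition torus_delta :: "'x \<Rightarrow> 'a \<Rightarrow> ('x, 'a::{field, finite}) mpoly" where
  "torus_delta v c = - (\<Sum>j<CARD('a) - 1. mconst (inverse c ^ j) * mvar v ^ j)"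

lemma torus_delta_closed [simp]: "v \<in> V \<Longrightarrow> torus_delta v c \<in> carrier (mpoly_ring V)"
  unfolding torus_delta_def by (intro mpoly_uminus_closed mpoly_sum_closed) simp

text \<open>Since c^(q-1) = 1, the coefficient \<open>inverse c ^ j\<close> is c^(q-1-j). So
  \<open>torus_delta v c\<close> is -c times the cofactor of t - c in t^(q-1) - c^(q-1) = t^(q-1) -
  1.\<close>

lemma torus_delta_mult:
  fixes v :: 'x and c :: "'a::{field, finite}"
  assumes "c \<noteq> 0"
  shows "(mvar v - mconst c) * torus_delta v c = - mconst c * (mvar v ^ (CARD('a) - 1) - 1)"
proof -
  have "card (- {0 :: 'a}) > 0"
    using assms by (auto simp: card_gt_0_iff)
  then obtain n where n: "CARD('a) - 1 = Suc n"
    by (metis card_nonzero gr0_implies_Suc)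
  have "inverse c ^ j = c * c ^ (n - j)" if "j < Suc n" for j
  proof -
    have "c ^ j * (c * c ^ (n - j)) = c ^ (CARD('a) - 1)"
      using that by (simp add: n[simplified] flip: power_Suc power_add)
    then show ?thesis
      using assms power_CARD_minus_1[OF assms] by (simp add: field_simps)
  qed
  then have "torus_delta v c = - mconst c * (\<Sum>j<Suc n. mvar v ^ j * mconst c ^ (n - j))"
    unfolding torus_delta_def n sum_distrib_left
    by (simp add: sum_negf[symmetric] mult_ac del: sum.lessThan_Suc)
  then have "(mvar v - mconst c) * torus_delta v c =
      - mconst c * ((mvar v - mconst c) * (\<Sum>j<Suc n. mvar v ^ j * mconst c ^ (n - j)))"
    by (simp only: mult_ac)
  also have "\<dots> = - mconst c * (mvar v ^ Suc n - mconst c ^ Suc n)"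
    by (simp only: diff_power_eq_sum)
  also have "mconst c ^ Suc n = (1 :: ('x, 'a) mpoly)"
    by (metis n power_CARD_minus_1[OF assms] mconst_simps(2,7))
  finally show ?thesis
    by (simp only: n)
qed

lemma mconst_sum: "mconst (\<Sum>s\<in>S. f s) = (\<Sum>s\<in>S. mconst (f s))"
  by (induction S rule: infinite_finite_induct) simp_all

text \<open>A partition of unity: after exchanging the sums, the coefficient of t^j is minus the sum
  of all \<open>inverse c ^ j\<close>. This is 0 for j > 0 and -(q - 1) = 1 for j = 0.\<close>

lemma sum_torus_delta:
  fixes v :: 'x
  shows "(\<Sum>c\<in>- {0 :: 'a::{field, finite}}. torus_delta v c) = 1"
proof -
  let ?n = "CARD('a) - 1"
  have n: "?n > 0"
    using card_nonzero[where 'a = 'a] by (metis ComplI card_gt_0_iff empty_iff finite singletonD zero_neq_one)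
  have "(of_nat ?n :: 'a) = - 1"
    using of_nat_CARD_eq_0[where 'a = 'a] by (simp add: of_nat_diff)
  then have S: "(\<Sum>c\<in>- {0 :: 'a}. inverse c ^ j) = (if j = 0 then - 1 else 0)" if "j < ?n" for j
    using sum_inverse_powers[of j, where 'a = 'a] that by (simp add: card_nonzero)
  have "(\<Sum>c\<in>- {0 :: 'a}. torus_delta v c) =
      - (\<Sum>c\<in>- {0}. \<Sum>j<?n. mconst (inverse c ^ j) * mvar v ^ j)"
    by (simp only: torus_delta_def sum_negf)
  also have "\<dots> = - (\<Sum>j<?n. mconst (\<Sum>c\<in>- {0}. inverse c ^ j) * mvar v ^ j)"
    by (subst sum.swap) (simp only: mconst_sum sum_distrib_right)
  also have "\<dots> = - (\<Sum>j<?n. if j = 0 then - 1 else 0)"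
    by (intro arg_cong[where f = uminus] sum.cong) (simp_all add: S)
  also have "\<dots> = 1"
    using n by simp
  finally show ?thesis .
qed

text \<open>By \<open>sum_torus_delta\<close>, \<open>p\<close> is the sum of its multiples by
  \<open>torus_delta w c\<close> over all nonzero \<open>c\<close>. Doing this for one variable of
  \<open>S\<close> after the other reduces membership to the indicators of single points.\<close>

lemma mem_ideal_if_torus_delta_mult_mem:
  fixes I :: "('x, 'a::{field, finite}) mpoly set"
  assumes "ideal I (mpoly_ring V)" "finite S"
    and "\<And>a. (\<And>v. a v \<noteq> 0) \<Longrightarrow> (\<Prod>v\<in>S. torus_delta v (a v)) * p \<in> I"
  shows "p \<in> I"
  using assms(2,3)
proof (induction S arbitrary: p)
  case empty
  then show ?case
    using empty[of "\<lambda>_. 1"] by simp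
next
  case (insert w S)
  have "torus_delta w c * p \<in> I" if "c \<noteq> 0" for c
  proof (rule insert.IH)
    fix a :: "'x \<Rightarrow> 'a" assume a: "\<And>v. a v \<noteq> 0"
    \<comment> \<open>The point \<open>a(w := c)\<close> has the prescribed coordinate at the new
      variable; as \<open>w \<notin> S\<close>, the product over \<open>S\<close> does not see the
      update.\<close>
    have "(\<Prod>v\<in>S. torus_delta v ((a(w := c)) v)) = (\<Prod>v\<in>S. torus_delta v (a v))"
      by (rule prod.cong) (use insert.hyps in auto)
    then show "(\<Prod>v\<in>S. torus_delta v (a v)) * (torus_delta w c * p) \<in> I"
      using insert.prems[of "a(w := c)"] insert.hyps a that by (simp add: mult_ac)
  qed
  then have "(\<Sum>c\<in>- {0}. torus_delta w c * p) \<in> I"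
    by (intro mpoly_ideal_sum[OF assms(1)]) simp
  then show ?case
    by (simp add: sum_torus_delta flip: sum_distrib_right)
qed

text \<open>Modulo \<open>I\<close>, multiplication by \<open>D\<close> turns a polynomial into its
  value at \<open>a\<close>. For a variable this is \<open>torus_delta_mult\<close> applied to the
  matching factor of \<open>D\<close>; sums and products follow by induction.\<close>

lemma torus_delta_localizes:
  fixes I :: "('x, 'a::{field, finite}) mpoly set"
  assumes I: "ideal I (mpoly_ring V)" and "finite V"
    and gens: "\<And>v. v \<in> V \<Longrightarrow> mvar v ^ (CARD('a) - 1) - 1 \<in> I"
    and a: "\<And>v. a v \<noteq> 0"
    and p: "p \<in> carrier (mpoly_ring V)"
  defines "D \<equiv> \<Prod>v\<in>V. torus_delta v (a v)"
  shows "D * (p - mconst (mpoly_eval a p)) \<in> I"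
  using p
proof (induction p rule: mpoly_carrier_induct)
  case (const c)
  then show ?case
    using mpoly_ideal_sum[OF I, of "{}"] by (simp add: mpoly_eval_mconst)
next
  case (var w)
  let ?D' = "\<Prod>v\<in>V - {w}. torus_delta v (a v)"
  have "D * (mvar w - mconst (a w)) = ?D' * ((mvar w - mconst (a w)) * torus_delta w (a w))"
    unfolding D_def by (subst prod.remove[OF \<open>finite V\<close> var]) (simp only: mult_ac)
  also have "\<dots> = (?D' * - mconst (a w)) * (mvar w ^ (CARD('a) - 1) - 1)"
    by (simp only: torus_delta_mult[OF a] mult.assoc)
  also have "\<dots> \<in> I"
    by (intro mpoly_ideal_mult[OF I] gens[OF var] mpoly_mult_closed mpoly_prod_closed) simp_all
  finally show ?case
    by simp
next
  case (add p q)
  then show ?case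
    using mpoly_ideal_add[OF I add(3,4)] by (simp add: mpoly_eval_add algebra_simps)
next
  case (mult p q)
  \<comment> \<open>This uses pq - p(a)q(a) = p(q - q(a)) + q(a)(p - p(a)).\<close>
  have "p * (D * (q - mconst (mpoly_eval a q))) +
      mconst (mpoly_eval a q) * (D * (p - mconst (mpoly_eval a p))) \<in> I"
    by (rule mpoly_ideal_add[OF I mpoly_ideal_mult[OF I mult(1,4)]
          mpoly_ideal_mult[OF I mpoly_mconst_closed mult(3)]])
  then show ?case
    by (simp add: mpoly_eval_mult algebra_simps)
qed

theorem torus_nullstellensatz:
  fixes I :: "('x, 'a::{field, finite}) mpoly set"
  assumes I: "ideal I (mpoly_ring V)" and "finite V"
    and gens: "\<And>v. v \<in> V \<Longrightarrow> mvar v ^ (CARD('a) - 1) - 1 \<in> I"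
    and p: "p \<in> carrier (mpoly_ring V)"
    and zeros: "\<And>a. \<lbrakk>\<And>v. a v \<noteq> 0; \<And>g. g \<in> I \<Longrightarrow> mpoly_eval a g = 0\<rbrakk> \<Longrightarrow> mpoly_eval a p = 0"
  shows "p \<in> I"
proof (rule mem_ideal_if_torus_delta_mult_mem[OF I \<open>finite V\<close>])
  fix a :: "'x \<Rightarrow> 'a" assume a: "\<And>v. a v \<noteq> 0"
  let ?D = "\<Prod>v\<in>V. torus_delta v (a v)"
  have loc: "?D * (g - mconst (mpoly_eval a g)) \<in> I" if "g \<in> carrier (mpoly_ring V)" for g
    by (rule torus_delta_localizes[OF I \<open>finite V\<close> gens a that])
  have D: "?D \<in> carrier (mpoly_ring V)"
    by (rule mpoly_prod_closed) simp
  show "?D * p \<in> I"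
  proof (cases "\<forall>g\<in>I. mpoly_eval a g = 0")
    case True
    then have "mpoly_eval a p = 0"
      using zeros a by blast
    then show ?thesis
      using loc[OF p] by simp
  next
    case False
    then obtain g where g: "g \<in> I" "mpoly_eval a g \<noteq> 0" by blast
    have gC: "g \<in> carrier (mpoly_ring V)"
      using ideal.Icarr[OF I g(1)] .
    \<comment> \<open>The difference is D times the nonzero constant g(a). Dividing by this constant
      and multiplying by \<open>p\<close> stays in \<open>I\<close>.\<close>
    have "?D * g - ?D * (g - mconst (mpoly_eval a g)) \<in> I"
      by (intro mpoly_ideal_diff[OF I] loc[OF gC] mpoly_ideal_mult[OF I D g(1)])
    then have "?D * mconst (mpoly_eval a g) \<in> I"
      by (simp add: algebra_simps)
    then have "p * mconst (inverse (mpoly_eval a g)) * (?D * mconst (mpoly_eval a g)) \<in> I"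
      by (rule mpoly_ideal_mult[OF I mpoly_mult_closed[OF p mpoly_mconst_closed]])
    moreover have "p * mconst (inverse (mpoly_eval a g)) * (?D * mconst (mpoly_eval a g)) =
        ?D * p * mconst (inverse (mpoly_eval a g) * mpoly_eval a g)"
      by (simp only: mconst_simps mult_ac)
    ultimately show ?thesis
      using g(2) by simp
  qed
qed

section \<open>Labelled cycles\<close>

text \<open>Division of \<open>l - 1\<close> by \<open>k\<close> gives the cycle \<open>j\<close>
  and the position \<open>n\<close>, both counted from 0. In these coordinates the successor on a
  cycle is \<open>Suc n mod k\<close>.\<close>

lemma index_decomposition:
  "l \<in> {1..k * m} \<longleftrightarrow> (\<exists>j<m. \<exists>n<k. l = Suc (j * k + n))" (is "?L \<longleftrightarrow> ?R")
proof
  assume ?L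
  then have "l - 1 < m * k" "l = Suc (l - 1)"
    by (auto simp: mult.commute)
  moreover from this have "k > 0"
    by (cases k) auto
  ultimately have "(l - 1) div k < m" "(l - 1) mod k < k"
      "l = Suc ((l - 1) div k * k + (l - 1) mod k)"
    by (simp_all add: less_mult_imp_div_less)
  then show ?R by blast
next
  assume ?R
  then obtain j n where l: "j < m" "n < k" "l = Suc (j * k + n)" by blast
  then have "l \<le> Suc j * k" by simp
  also have "\<dots> \<le> m * k"
    using l by (intro mult_le_mono1) simp
  finally show ?L
    using l by (simp add: mult.commute)
qed

lemma bij_betw_block: "bij_betw (\<lambda>n. Suc (j * k + n)) {..<k} (block k (Suc j))"
  by (rule bij_betwI[where g = "\<lambda>l. l - Suc (j * k)"]) (auto simp: block_def)

lemma card_block: "card (block k (Suc j)) = k"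
  by (simp add: block_def)

lemma finite_block [simp]: "finite (block k j)"
  by (simp add: block_def)

lemma block_subset: "j \<in> {1..m} \<Longrightarrow> block k j \<subseteq> {1..k * m}"
proof
  fix l assume "j \<in> {1..m}" "l \<in> block k j"
  then have "l \<ge> 1" "l \<le> j * k" "j * k \<le> m * k"
    by (auto simp: block_def intro: mult_le_mono1)
  then show "l \<in> {1..k * m}"
    using order.trans[of l "j * k" "m * k"] by (simp add: mult.commute)
qed

text \<open>For \<open>n < k\<close>, the index is a multiple of \<open>k\<close> exactly at the
  last position n = k - 1, which is where the modular successor wraps to 0.\<close>

lemma cycle_edge_block:
  assumes "n < k"
  shows "cycle_edge k x (Suc (j * k + n)) = {x (Suc (j * k + n)), x (Suc (j * k + Suc n mod k))}"
proof (cases "Suc n = k")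
  case True
  then have "Suc (j * k + n) = Suc j * k" "Suc (j * k + n) + 1 - k = Suc (j * k)" by simp_all
  moreover from this have "k dvd Suc (j * k + n)"
    by (metis dvd_triv_right)
  ultimately show ?thesis
    using True by (simp add: cycle_edge_def)
next
  case False
  then have "Suc n < k" using assms by simp
  moreover from this have "\<not> k dvd Suc (j * k + n)"
    by (metis add_Suc_right dvd_add_right_iff dvd_triv_right nat_dvd_not_less zero_less_Suc)
  ultimately show ?thesis
    by (simp add: cycle_edge_def)
qed

text \<open>The labelling describes the components, so the edge is found in a cycle graph and then
  passes to \<open>G\<close>, because components are induced subgraphs. Membership is needed to
  evaluate \<open>restrict\<close> in the toric set.\<close>

lemma cycle_edge_in_edges:
  assumes G: "cycles_labelling G m k x" and "j < m" "n < k"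
  shows "cycle_edge k x (Suc (j * k + n)) \<in> edges G"
proof -
  let ?xs = "map x (sorted_list_of_set (block k (Suc j)))"
  have block: "sorted_list_of_set (block k (Suc j)) = [Suc (j * k)..<Suc (j * k + k)]"
  proof -
    have "block k (Suc j) = {Suc (j * k)..<Suc (j * k + k)}"
      by (auto simp: block_def)
    then show ?thesis
      by (simp only: sorted_list_of_set_range)
  qed
  have "Suc n mod k < k"
    using assms(3) by simp
  then have "cycle_edge k x (Suc (j * k + n)) = {?xs ! n, ?xs ! (Suc n mod length ?xs)}"
    unfolding block using assms(3) by (simp add: cycle_edge_block del: upt_Suc)
  moreover have "n < length ?xs"
    unfolding block using assms(3) by simp
  ultimately have "cycle_edge k x (Suc (j * k + n)) \<in> edges (cycle_graph ?xs)"
    unfolding cycle_graph_def ugraph.simps by blast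
  moreover have "cycle_graph ?xs \<in> components G"
    using G assms(2) by (auto simp: cycles_labelling_def)
  ultimately show ?thesis
    by (auto simp: components_def induced_subgraph_def)
qed

text \<open>For \<open>k \<ge> 2\<close> the two positions differ and \<open>x\<close> is injective
  on the labels, so the edge has two distinct ends and no factor is lost in the product over the
  set.\<close>

lemma prod_cycle_edge:
  assumes G: "cycles_labelling G m k x" and "k \<ge> 2" "j < m" "n < k"
  shows "(\<Prod>v\<in>cycle_edge k x (Suc (j * k + n)). y v) =
    y (x (Suc (j * k + n))) * y (x (Suc (j * k + Suc n mod k)))"
proof -
  have "Suc n mod k \<noteq> n"
    using assms(2,4) by (auto simp: mod_Suc)
  moreover have "Suc n mod k < k"
    using assms(4) by simp
  then have "Suc (j * k + n) \<in> {1..k * m}" "Suc (j * k + Suc n mod k) \<in> {1..k * m}"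
    using assms(3,4) unfolding index_decomposition by blast+
  ultimately have "x (Suc (j * k + n)) \<noteq> x (Suc (j * k + Suc n mod k))"
    using G unfolding cycles_labelling_def by (metis Suc_inject add_left_cancel inj_onD)
  then show ?thesis
    by (simp add: cycle_edge_block[OF assms(4)])
qed

text \<open>The successor is a cyclic shift of the positions, so each vertex contributes to two
  edges.\<close>

lemma prod_cycle:
  fixes z :: "nat \<Rightarrow> 'a::comm_monoid_mult"
  shows "(\<Prod>n<k. z n * z (Suc n mod k)) = (\<Prod>n<k. z n) ^ 2"
proof (cases k)
  case (Suc k')
  have "(\<Prod>n<k. z (Suc n mod k)) = (\<Prod>n<k'. z (Suc n)) * z 0"
    unfolding Suc by (simp add: mult.commute)
  also have "\<dots> = (\<Prod>n<k. z n)"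
    unfolding Suc prod.lessThan_Suc_shift by (simp add: mult.commute)
  finally show ?thesis
    by (simp add: prod.distrib power2_eq_square)
qed simp

text \<open>The product of all \<open>e n\<close> is \<open>(y 0 \<cdots> y (2 * g))\<^sup>2\<close> and the product over the odd \<open>n\<close> is
  \<open>y 1 \<cdots> y (2 * g)\<close>, which forces \<open>y 0 = s / (e 1 * e 3 * \<cdots> * e (2 * g - 1))\<close> up to the sign.\<close>

lemma odd_cycle_solution:
  fixes e :: "nat \<Rightarrow> 'a::field"
  assumes e: "\<And>n. e n \<noteq> 0" and s: "(\<Prod>n<2 * g + 1. e n) = s ^ 2" "s \<noteq> 0"
  obtains y where "\<And>n. y n \<noteq> 0" "\<And>n. n < 2 * g + 1 \<Longrightarrow> y n * y (Suc n mod (2 * g + 1)) = e n"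
proof -
  \<comment> \<open>The recursion solves every edge equation except the closing one; the start value
    is chosen to satisfy that one.\<close>
  define y where "y = rec_nat (s / (\<Prod>i<g. e (2 * i + 1))) (\<lambda>n t. e n / t)"
  have y0: "y 0 = s / (\<Prod>i<g. e (2 * i + 1))" and ySuc: "y (Suc n) = e n / y n" for n
    by (simp_all add: y_def)
  have nz: "y n \<noteq> 0" for n
    by (induction n) (simp_all add: y0 ySuc e s)
  have step: "y n * y (Suc n) = e n" for n
    using nz by (simp add: ySuc)
  \<comment> \<open>Two steps of the recursion multiply the value by
    \<open>e (2 * n + 1) / e (2 * n)\<close>; this is iterated up to the last vertex
    \<open>2 * g\<close>.\<close>
  have even: "y (2 * n) * (\<Prod>i<n. e (2 * i)) = y 0 * (\<Prod>i<n. e (2 * i + 1))" for n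
  proof (induction n)
    case (Suc n)
    have "y (2 * Suc n) * (\<Prod>i<Suc n. e (2 * i)) = (y (2 * Suc n) * e (2 * n)) * (\<Prod>i<n. e (2 * i))"
      by (simp add: mult_ac)
    also have "y (2 * Suc n) * e (2 * n) = y (2 * n) * e (2 * n + 1)"
      using nz by (simp add: ySuc e)
    also have "\<dots> * (\<Prod>i<n. e (2 * i)) = e (2 * n + 1) * (y (2 * n) * (\<Prod>i<n. e (2 * i)))"
      by (simp only: mult_ac)
    also have "\<dots> = e (2 * n + 1) * (y 0 * (\<Prod>i<n. e (2 * i + 1)))"
      by (simp only: Suc.IH)
    also have "\<dots> = y 0 * (\<Prod>i<Suc n. e (2 * i + 1))"
      by (simp only: prod.lessThan_Suc mult_ac)
    finally show ?case .
  qed simp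
  have "(\<Prod>n<2 * g. e n) = (\<Prod>i<g. e (2 * i)) * (\<Prod>i<g. e (2 * i + 1))"
    by (induction g) simp_all
  then have prod: "(\<Prod>i<g. e (2 * i)) * (\<Prod>i<g. e (2 * i + 1)) * e (2 * g) = s ^ 2"
    using s(1) by simp
  have E: "(\<Prod>i<g. e (2 * i)) \<noteq> 0" and O: "(\<Prod>i<g. e (2 * i + 1)) \<noteq> 0"
    by (simp_all add: e)
  have "y (2 * g) * (\<Prod>i<g. e (2 * i)) = s"
    using even[of g] O unfolding y0 by simp
  \<comment> \<open>Both ends of the closing edge are \<open>s\<close> divided by a partial product,
    over the even and the odd indices below \<open>2 * g\<close>; what remains of
    \<open>s ^ 2\<close> is \<open>e (2 * g)\<close>.\<close>
  then have "y (2 * g) * y 0 = s ^ 2 / ((\<Prod>i<g. e (2 * i)) * (\<Prod>i<g. e (2 * i + 1)))"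
    using E unfolding y0 by (subst (asm) nonzero_eq_divide_eq[symmetric]) (simp_all add: power2_eq_square)
  also have "\<dots> = e (2 * g)"
    using E O unfolding prod[symmetric] by simp
  finally have last: "y (2 * g) * y 0 = e (2 * g)" .
  show thesis
  proof (rule that[OF nz])
    fix n assume "n < 2 * g + 1"
    then show "y n * y (Suc n mod (2 * g + 1)) = e n"
      using step[of n] last by (cases "n = 2 * g") simp_all
  qed
qed

text \<open>The left side u satisfies u^2 = 1, being a (q-1)-th power after squaring. So u = w is
  equivalent to w u = 1, and w u is the h-th power of the full product.\<close>

lemma prod_powers_eq_complement_iff:
  fixes f :: "'b \<Rightarrow> 'a::{field, finite}"
  assumes "finite S" "B \<subseteq> S" and f: "\<And>s. f s \<noteq> 0" and h: "2 * h = CARD('a) - 1"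
  shows "(\<Prod>s\<in>B. f s ^ h) = (\<Prod>s\<in>S - B. f s ^ h) \<longleftrightarrow> (\<Prod>s\<in>S. f s) ^ h = 1"
proof -
  let ?u = "\<Prod>s\<in>B. f s ^ h" and ?w = "\<Prod>s\<in>S - B. f s ^ h"
  have "?u = (\<Prod>s\<in>B. f s) ^ h"
    by (simp add: prod_power_distrib)
  then have "?u * ?u = (\<Prod>s\<in>B. f s) ^ (CARD('a) - 1)"
    using h by (simp flip: power_add mult_2)
  also have "\<dots> = 1"
    using assms by (intro power_CARD_minus_1) (meson finite_subset prod_zero_iff)
  finally have "?u * ?u = 1" .
  moreover have "(\<Prod>s\<in>S. f s) ^ h = ?w * ?u"
    using prod.subset_diff[OF assms(2,1), of "\<lambda>s. f s ^ h"] by (simp add: prod_power_distrib)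
  ultimately show ?thesis
    by (metis mult_cancel_right mult_zero_left zero_neq_one)
qed

section \<open>The vanishing ideal of a union of odd cycles\<close>

lemma A_binomials_closed:
  assumes "j \<in> {1..m}" "{i} \<times> {1..k * m} \<subseteq> V"
  shows "A_binomials q g k i j \<subseteq> carrier (mpoly_ring V)"
proof
  fix p :: "(nat \<times> nat, 'a) mpoly" assume "p \<in> A_binomials q g k i j"
  then obtain B where p: "B \<subseteq> block k j" "p = (\<Prod>\<alpha>\<in>B. tvar i \<alpha> ^ ((q - 1) div 2)) -
      (\<Prod>w\<in>block k j - B. tvar i w ^ ((q - 1) div 2))"
    unfolding A_binomials_def by blast
  have "(i, l) \<in> V" if "l \<in> block k j" for l
    using that block_subset[OF assms(1), of k] assms(2) by blast
  then show "p \<in> carrier (mpoly_ring V)"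
    unfolding p(2) using p(1)
    by (intro mpoly_diff_closed mpoly_prod_closed mpoly_power_closed mpoly_mvar_closed) auto
qed

text \<open>The criterion of \<open>prod_powers_eq_complement_iff\<close> does not depend on
  \<open>B\<close>, so all binomials of a cycle impose the same condition. The bound on
  \<open>g\<close> provides at least one \<open>B\<close>, so the left side is not vacuous.\<close>

lemma A_binomials_vanish_iff:
  fixes a :: "nat \<times> nat \<Rightarrow> 'a::{field, finite}"
  assumes "\<And>v. a v \<noteq> 0" "odd CARD('a)" "g \<le> card (block k j)"
  shows "(\<forall>p\<in>A_binomials CARD('a) g k i j. mpoly_eval a p = 0) \<longleftrightarrow>
    (\<Prod>l\<in>block k j. a (i, l)) ^ ((CARD('a) - 1) div 2) = 1" (is "?L \<longleftrightarrow> ?R")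
proof -
  let ?h = "(CARD('a) - 1) div 2"
  have h: "2 * ?h = CARD('a) - 1"
    using assms(2) by simp
  have "(\<Prod>l\<in>B. a (i, l) ^ ?h) = (\<Prod>l\<in>block k j - B. a (i, l) ^ ?h) \<longleftrightarrow> ?R"
    if "B \<subseteq> block k j" for B
    by (rule prod_powers_eq_complement_iff[OF finite_block that _ h]) (rule assms(1))
  then have eval: "mpoly_eval a ((\<Prod>\<alpha>\<in>B. tvar i \<alpha> ^ ?h) - (\<Prod>w\<in>block k j - B. tvar i w ^ ?h)) = 0 \<longleftrightarrow> ?R"
    if "B \<subseteq> block k j" for B
    using that by (simp only: mpoly_eval_diff mpoly_eval_prod mpoly_eval_power mpoly_eval_mvar
        right_minus_eq)
  show ?thesis
  proof
    assume L: ?L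
    obtain B where B: "B \<subseteq> block k j" "card B = g"
      using obtain_subset_with_card_n[OF assms(3)] by blast
    show ?R
      by (rule iffD1[OF eval[OF B(1)]], rule bspec[OF L]) (use B in \<open>auto simp: A_binomials_def\<close>)
  next
    assume R: ?R
    show ?L
    proof
      fix p :: "(nat \<times> nat, 'a) mpoly"
      assume "p \<in> A_binomials CARD('a) g k i j"
      then obtain B where "B \<subseteq> block k j"
          "p = (\<Prod>\<alpha>\<in>B. tvar i \<alpha> ^ ?h) - (\<Prod>w\<in>block k j - B. tvar i w ^ ?h)"
        unfolding A_binomials_def by blast
      then show "mpoly_eval a p = 0"
        using eval R by simp
    qed
  qed
qed

theorem theorem3p11:
  fixes q r :: nat and m \<gamma> k :: "nat \<Rightarrow> nat"
    and G :: "nat \<Rightarrow> 'v ugraph" and x :: "nat \<Rightarrow> nat \<Rightarrow> 'v"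
    and V :: "(nat \<times> nat) set"
    and X :: "('v set \<Rightarrow> 'a::{field, finite}) set"
  assumes "q = CARD('a)" and "odd q"
    and "r \<ge> 1"
    and "\<And>i. i \<in> {1..r} \<Longrightarrow> m i \<ge> 1"
    and "\<And>i. i \<in> {1..r} \<Longrightarrow> \<gamma> i \<ge> 1"
    and "\<And>i. i \<in> {1..r} \<Longrightarrow> k i = 2 * \<gamma> i + 1"
    and "\<And>i. i \<in> {1..r} \<Longrightarrow> simple_graph (G i)"
    and "\<And>i. i \<in> {1..r} \<Longrightarrow> cycles_labelling (G i) (m i) (k i) (x i)"
    and "disjoint_family_on (\<lambda>i. verts (G i)) {1..r}"
    and "V = (SIGMA i:{1..r}. {1..k i * m i})"
    and "X = affine_toric_set (union_graph {1..r} G)"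
  shows "vanishing_ideal V (numbered_points (\<lambda>(i, l). cycle_edge (k i) (x i) l) X) =
    Idl\<^bsub>mpoly_ring V\<^esub>
      ((\<Union>i\<in>{1..r}. {tvar i l ^ (q - 1) - 1 | l. l \<in> {1..k i * m i}}) \<union>
       (\<Union>i\<in>{1..r}. \<Union>j\<in>{1..m i}. A_binomials q (\<gamma> i) (k i) i j))"
    (is "vanishing_ideal V ?X = Idl\<^bsub>mpoly_ring V\<^esub> (?T \<union> ?A)")
proof
  note q = \<open>q = CARD('a)\<close> and k = assms(6) and lab = assms(8) and V = assms(10)
  let ?\<epsilon> = "\<lambda>(i, l). cycle_edge (k i) (x i) l"
  let ?E = "edges (union_graph {1..r} G)"
  interpret cring "mpoly_ring V :: (nat \<times> nat, 'a) mpoly ring"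
    by (rule cring_mpoly_ring)

  have "?T \<subseteq> carrier (mpoly_ring V)"
  proof (intro UN_least subsetI)
    fix i p assume "i \<in> {1..r}" "p \<in> {tvar i l ^ (q - 1) - 1 | l. l \<in> {1..k i * m i}}"
    then obtain l where "(i, l) \<in> V" "p = tvar i l ^ (q - 1) - 1"
      unfolding V by blast
    then show "p \<in> carrier (mpoly_ring V)"
      by simp
  qed
  moreover have "?A \<subseteq> carrier (mpoly_ring V)"
  proof (intro UN_least)
    fix i j assume ij: "i \<in> {1..r}" "j \<in> {1..m i}"
    then have "{i} \<times> {1..k i * m i} \<subseteq> V"
      unfolding V by blast
    then show "A_binomials q (\<gamma> i) (k i) i j \<subseteq> carrier (mpoly_ring V)"
      by (rule A_binomials_closed[OF ij(2)])
  qed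
  ultimately have gens: "?T \<union> ?A \<subseteq> carrier (mpoly_ring V)"
    by (rule Un_least)
  let ?I = "Idl\<^bsub>mpoly_ring V\<^esub> (?T \<union> ?A)"
  note I = genideal_ideal[OF gens] and gens_I = genideal_self[OF gens]

  have gamma_le: "\<gamma> i \<le> card (block (k i) (Suc j))" if "i \<in> {1..r}" for i j
    unfolding card_block k[OF that] by simp
  have verts: "x i (Suc (j * k i + n)) \<in> verts (G i)"
    if "i \<in> {1..r}" "j < m i" "n < k i" for i j n
  proof -
    have "Suc (j * k i + n) \<in> {1..k i * m i}"
      using that index_decomposition by blast
    then show ?thesis
      using lab[OF that(1)] by (auto simp: cycles_labelling_def)
  qed
  \<comment> \<open>On an actual edge \<open>restrict\<close> returns the vertex product, which has
    two factors since \<open>k i \<ge> 3\<close>.\<close>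
  have toric: "restrict (\<lambda>e. \<Prod>v\<in>e. y v) ?E (cycle_edge (k i) (x i) (Suc (j * k i + n))) =
      y (x i (Suc (j * k i + n))) * y (x i (Suc (j * k i + Suc n mod k i)))"
    if "i \<in> {1..r}" "j < m i" "n < k i" for y :: "'v \<Rightarrow> 'a" and i j n
  proof -
    have "cycle_edge (k i) (x i) (Suc (j * k i + n)) \<in> ?E"
      using cycle_edge_in_edges[OF lab that(2,3)] that(1) by (auto simp: union_graph_def)
    moreover have "k i \<ge> 2"
      using k assms(5) that(1) by fastforce
    ultimately show ?thesis
      using prod_cycle_edge[OF lab _ that(2,3)] that(1) by simp
  qed

  \<comment> \<open>The generators vanish on the toric set\<close>
  show "?I \<subseteq> vanishing_ideal V ?X"
  proof (rule genideal_minimal[OF ideal_vanishing_ideal], rule subsetI)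
    fix p assume p: "p \<in> ?T \<union> ?A"
    then have pC: "p \<in> carrier (mpoly_ring V)"
      using gens by blast
    have "mpoly_eval P p = 0" if "P \<in> ?X" for P
    proof -
      obtain y where y: "\<And>v. v \<in> verts (union_graph {1..r} G) \<Longrightarrow> y v \<noteq> 0"
        and P: "P = restrict (\<lambda>e. \<Prod>v\<in>e. y v) ?E \<circ> ?\<epsilon>"
        using \<open>P \<in> ?X\<close> unfolding assms(11) numbered_points_def affine_toric_set_def by blast
      \<comment> \<open>The value 1 outside \<open>V\<close> makes \<open>a\<close> nonzero
        everywhere, as the lemmas on torus points require; \<open>p\<close> only involves variables
        in \<open>V\<close>, so its value is unchanged.\<close>
      define a where "a v = (if v \<in> V then P v else 1)" for v
      have Pa: "mpoly_eval P p = mpoly_eval a p"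
        by (rule mpoly_eval_cong[OF pC]) (simp add: a_def)
      have inV: "(i, Suc (j * k i + n)) \<in> V" if "i \<in> {1..r}" "j < m i" "n < k i" for i j n
        unfolding V using that index_decomposition by blast
      have a_eq: "a (i, Suc (j * k i + n)) =
          y (x i (Suc (j * k i + n))) * y (x i (Suc (j * k i + Suc n mod k i)))"
        if "i \<in> {1..r}" "j < m i" "n < k i" for i j n
        using toric[OF that] inV[OF that] by (simp add: a_def P)
      have y_nz: "y (x i (Suc (j * k i + n))) \<noteq> 0" if "i \<in> {1..r}" "j < m i" "n < k i" for i j n
      proof (rule y)
        show "x i (Suc (j * k i + n)) \<in> verts (union_graph {1..r} G)"
          using verts[OF that] that(1) by (auto simp: union_graph_def)
      qed
      have a_nz: "a v \<noteq> 0" for v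
      proof (cases "v \<in> V")
        case True
        then obtain i l where v: "v = (i, l)" "i \<in> {1..r}" "l \<in> {1..k i * m i}"
          unfolding V by blast
        then obtain j n where jn: "j < m i" "n < k i" "l = Suc (j * k i + n)"
          using index_decomposition by blast
        then have "Suc n mod k i < k i" by simp
        then show ?thesis
          using v jn by (simp add: a_eq y_nz)
      qed (simp add: a_def)
      consider i l where "i \<in> {1..r}" "p = tvar i l ^ (q - 1) - 1"
        | i j where "i \<in> {1..r}" "j \<in> {1..m i}" "p \<in> A_binomials q (\<gamma> i) (k i) i j"
      proof (cases "p \<in> ?T")
        case True
        then show ?thesis
          using that(1) by blast
      next
        case False
        then have "p \<in> ?A"
          using p by blast
        then show ?thesis
          using that(2) by (elim UN_E)
      qed
      then have "mpoly_eval a p = 0"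
      proof cases
        case 1
        then show ?thesis
          using power_CARD_minus_1[OF a_nz]
          by (simp add: mpoly_eval_diff mpoly_eval_power q)
      next
        case (2 i j')
        then obtain j where j: "j' = Suc j" "j < m i"
          by (cases j') auto
        note 2 = 2(1) j(2) 2(3)[unfolded j(1)]
        let ?z = "\<lambda>n. y (x i (Suc (j * k i + n)))"
        \<comment> \<open>The edge coordinates of a cycle multiply to the square of the product of
          its vertex values, whose (q-1)-th power is 1.\<close>
        have "(\<Prod>l\<in>block (k i) (Suc j). a (i, l)) = (\<Prod>n<k i. a (i, Suc (j * k i + n)))"
          by (rule prod.reindex_bij_betw[OF bij_betw_block, symmetric])
        also have "\<dots> = (\<Prod>n<k i. ?z n * ?z (Suc n mod k i))"
          using 2 by (intro prod.cong) (simp_all add: a_eq)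
        also have "\<dots> = (\<Prod>n<k i. ?z n) ^ 2"
          by (rule prod_cycle)
        finally have "(\<Prod>l\<in>block (k i) (Suc j). a (i, l)) ^ ((CARD('a) - 1) div 2) =
            (\<Prod>n<k i. ?z n) ^ (CARD('a) - 1)"
          using \<open>odd q\<close> by (simp add: q flip: power_mult)
        also have "\<dots> = 1"
          using 2 y_nz by (intro power_CARD_minus_1) simp
        finally have "\<forall>p\<in>A_binomials CARD('a) (\<gamma> i) (k i) i (Suc j). mpoly_eval a p = 0"
          by (subst A_binomials_vanish_iff[OF a_nz \<open>odd q\<close>[unfolded q] gamma_le[OF 2(1)]])
        then show ?thesis
          using 2(3) q by blast
      qed
      then show ?thesis
        using Pa by simp
    qed
    then show "p \<in> vanishing_ideal V ?X"
      using pC by (simp add: vanishing_ideal_def)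
  qed

  \<comment> \<open>Polynomials vanishing on the toric set lie in the ideal\<close>
  show "vanishing_ideal V ?X \<subseteq> ?I"
  proof
    fix p assume p: "p \<in> vanishing_ideal V ?X"
    then have pC: "p \<in> carrier (mpoly_ring V)"
      by (simp add: vanishing_ideal_def)
    show "p \<in> ?I"
    \<comment> \<open>It remains to show that each torus zero \<open>a\<close> of the ideal agrees
      on \<open>V\<close> with a point of the toric set.\<close>
    proof (rule torus_nullstellensatz[OF I _ _ pC])
      show "finite V"
        by (simp add: V)
      show "mvar v ^ (CARD('a) - 1) - 1 \<in> ?I" if "v \<in> V" for v
      proof -
        obtain i l where v: "v = (i, l)" "i \<in> {1..r}" "l \<in> {1..k i * m i}"
          using \<open>v \<in> V\<close> unfolding V by blast
        have "tvar i l ^ (q - 1) - 1 \<in> {tvar i l ^ (q - 1) - 1 | l. l \<in> {1..k i * m i}}"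
          using v(3) by blast
        then have "tvar i l ^ (q - 1) - 1 \<in> ?T"
          by (rule UN_I[OF v(2)])
        then show ?thesis
          using gens_I unfolding v(1) q by blast
      qed
    next
      fix a :: "nat \<times> nat \<Rightarrow> 'a"
      assume a: "\<And>v. a v \<noteq> 0" and zero: "\<And>g. g \<in> ?I \<Longrightarrow> mpoly_eval a g = 0"
      \<comment> \<open>Each cycle is solved separately: the binomials make the product of its
        coordinates a square, and the odd length then gives vertex values.\<close>
      have "\<exists>z. (\<forall>n. z n \<noteq> 0) \<and> (\<forall>n<k i. z n * z (Suc n mod k i) = a (i, Suc (j * k i + n)))"
        if ij: "i \<in> {1..r}" "j < m i" for i j
      proof -
        have "Suc j \<in> {1..m i}"
          using ij by simp
        then have "A_binomials q (\<gamma> i) (k i) i (Suc j) \<subseteq> ?A"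
          using ij(1) by blast
        then have "\<forall>p\<in>A_binomials q (\<gamma> i) (k i) i (Suc j). mpoly_eval a p = 0"
          using gens_I zero by blast
        then have "(\<Prod>l\<in>block (k i) (Suc j). a (i, l)) ^ ((CARD('a) - 1) div 2) = 1"
          unfolding q A_binomials_vanish_iff[OF a \<open>odd q\<close>[unfolded q] gamma_le[OF ij(1)]] .
        then have "(\<Prod>n<k i. a (i, Suc (j * k i + n))) ^ ((CARD('a) - 1) div 2) = 1"
          using prod.reindex_bij_betw[OF bij_betw_block, of "\<lambda>l. a (i, l)" j "k i"] by simp
        then obtain s where "(\<Prod>n<k i. a (i, Suc (j * k i + n))) = s ^ 2" "s \<noteq> 0"
          using square_if_power_half_eq_1 \<open>odd q\<close> q by metis
        then obtain z where "\<And>n. z n \<noteq> 0"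
          "\<And>n. n < k i \<Longrightarrow> z n * z (Suc n mod k i) = a (i, Suc (j * k i + n))"
          using odd_cycle_solution[of "\<lambda>n. a (i, Suc (j * k i + n))" "\<gamma> i"] a
          unfolding k[OF ij(1)] by metis
        then show ?thesis by blast
      qed
      then obtain z where z_nz: "\<And>i j n. \<lbrakk>i \<in> {1..r}; j < m i\<rbrakk> \<Longrightarrow> z i j n \<noteq> 0"
        and z: "\<And>i j n. \<lbrakk>i \<in> {1..r}; j < m i; n < k i\<rbrakk> \<Longrightarrow>
          z i j n * z i j (Suc n mod k i) = a (i, Suc (j * k i + n))"
        by metis
      \<comment> \<open>The solutions are glued by reading off the label of a vertex and splitting
        it into cycle and position. Off the labelled vertices \<open>inv_into\<close> is arbitrary;
        the default 1 keeps \<open>y\<close> nonzero there as well.\<close>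
      define y where "y v = (let (i, l) = inv_into V (\<lambda>(i, l). x i l) v in
        if i \<in> {1..r} \<and> (l - 1) div k i < m i then z i ((l - 1) div k i) ((l - 1) mod k i) else 1)" for v
      have y_nz: "y v \<noteq> 0" for v
        unfolding y_def Let_def by (simp add: z_nz split: prod.split)
      \<comment> \<open>Different \<open>i\<close> are separated by the disjoint vertex sets, equal
        \<open>i\<close> by injectivity of the labelling.\<close>
      have inj: "inj_on (\<lambda>(i, l). x i l) V"
      proof (rule inj_onI, clarify)
        have mem: "x i l \<in> verts (G i)" if "(i, l) \<in> V" for i l
          using that lab[of i] unfolding V cycles_labelling_def by auto
        fix i l i' l' assume V': "(i, l) \<in> V" "(i', l') \<in> V" and eq: "x i l = x i' l'"
        then have "x i l \<in> verts (G i)" "x i l \<in> verts (G i')"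
          using mem[OF V'(1)] mem[OF V'(2)] by simp_all
        then have "i = i'"
          using assms(9) V' eq unfolding V disjoint_family_on_def by fastforce
        moreover from this have "l = l'"
          using lab[of i] V' eq unfolding V cycles_labelling_def by (auto dest: inj_onD)
        ultimately show "i = i' \<and> l = l'" ..
      qed
      have y: "y (x i (Suc (j * k i + n))) = z i j n" if "i \<in> {1..r}" "j < m i" "n < k i" for i j n
      proof -
        have "(i, Suc (j * k i + n)) \<in> V"
          unfolding V using that index_decomposition by blast
        then have "inv_into V (\<lambda>(i, l). x i l) (x i (Suc (j * k i + n))) = (i, Suc (j * k i + n))"
          using inv_into_f_f[OF inj] by fastforce
        then show ?thesis
          using that by (simp add: y_def)
      qed
      let ?P = "restrict (\<lambda>e. \<Prod>v\<in>e. y v) ?E \<circ> ?\<epsilon>"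
      have "?P \<in> ?X"
        unfolding assms(11) numbered_points_def affine_toric_set_def using y_nz by blast
      then have "mpoly_eval ?P p = 0"
        using p by (simp add: vanishing_ideal_def)
      moreover have "mpoly_eval a p = mpoly_eval ?P p"
      proof (rule mpoly_eval_cong[OF pC])
        fix v assume "v \<in> V"
        then obtain i l where v: "v = (i, l)" "i \<in> {1..r}" "l \<in> {1..k i * m i}"
          unfolding V by blast
        then obtain j n where jn: "j < m i" "n < k i" "l = Suc (j * k i + n)"
          using index_decomposition by blast
        then have "Suc n mod k i < k i" by simp
        then show "a v = ?P v"
          using v jn toric[OF v(2) jn(1,2)] by (simp add: y z)
      qed
      ultimately show "mpoly_eval a p = 0" by simp
    qed
  qed
qed

end
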